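(* Let $\Gamma=(V\uplus A,E,\alpha,c,\lambda)$ be a gainy marked network with at least all sinks marked. Then the transfer map $\phi_\Gamma\colon\mathbb{R}^V\to\mathbb{R}^V$, $$\phi_\Gamma(x)_v = x_v-\max_{v\xrightarrow{e}w}(\alpha_e x_w+c_e)\quad (v\in V),$$ restricts to a piecewise-linear homeomorphism $\mathcal{O}(\Gamma)\to\mathcal{C}(\Gamma)$.
   Context: A marked network $\Gamma=(V\uplus A,E,\alpha,c,\lambda)$ consists of a finite loop-free directed multigraph on the node set $V\uplus A$ with edge set $E$ (nodes in $A$ are called marked, nodes in $V$ unmarked), weights $\alpha_e,c_e\in\mathbb{R}$ with $\alpha_e>0$ for each edge $e\in E$, and a marking $\lambda\in\mathbb{R}^A$. For $x\in\mathbb{R}^V$ one sets $x_a:=\lambda_a$ for $a\in A$. A sink is a node without outgoing edges; "all sinks marked" means every sink lies in $A$. In the definition of $\phi_\Gamma$ the maximum is over all edges $e$ starting in $v$ (with $w$ the end node of $e$). The polyhedron $\mathcal{O}(\Gamma)\subseteq\mathbb{R}^V$ is the set of all $x\in\mathbb{R}^V$ with $\alpha_e x_w+c_e\le x_v$ for all edges $v\xrightarrow{e}w$ in $E$. A path is a finite walk with pairwise distinct nodes (length $0$ allowed). A cycle is a finite walk $v_1\xrightarrow{e_1}v_2\to\cdots\xrightarrow{e_r}v_{r+1}=v_1$ ($r\ge 1$) with $v_1,\dots,v_r$ pairwise distinct. The weight of a finite walk with edges $e_1,\dots,e_r$ is $\prod_{i=1}^r\alpha_{e_i}$. The network is gainy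 if every cycle $C$ has weight $\alpha(C)<1$. $\mathcal{W}$ is the set consisting of all finite walks $v_1\xrightarrow{e_1}\cdots\xrightarrow{e_r}v_{r+1}$ ($r\ge0$) with $v_i\in V$ for $i\le r$ and $v_{r+1}\in A$, and all infinite walks $v_1\xrightarrow{e_1}v_2\xrightarrow{e_2}\cdots$ with all $v_i\in V$. For $W\in\mathcal{W}$ and $x\in\mathbb{R}^V$: if $W$ is finite, $$\Sigma(W)(x)=\sum_{k=1}^r\Big(\prod_{j=1}^{k-1}\alpha_{e_j}\Big)(x_{v_k}+c_{e_k})+\Big(\prod_{j=1}^r\alpha_{e_j}\Big)x_{v_{r+1}};$$ if $W$ is infinite, $\Sigma(W)(x)=\sum_{k=1}^\infty\big(\prod_{j=1}^{k-1}\alpha_{e_j}\big)(x_{v_k}+c_{e_k})$ (for gainy networks this series converges absolutely). $\widehat{\mathcal{W}}\subseteq\mathcal{W}$ is the subset of walks that are either a path (necessarily ending in a marked node) or a monocycle, i.e. an infinite walk of the form $v_1\xrightarrow{e_1}\cdots\xrightarrow{e_{s-1}}v_s\xrightarrow{e_s}\cdots\xrightarrow{e_{r-1}}v_r\xrightarrow{e_r}v_s\xrightarrow{e_s}\cdots$ which after reaching $v_s$ repeats the cycle $v_s\xrightarrow{e_s}\cdots\xrightarrow{e_{r-1}}v_r\xrightarrow{e_r}v_s$ forever, with $v_1,\dots,v_r\in V$ pairwise distinct and $1\le s\le r$. The polyhedron $\mathcal{C}(\Gamma)\subseteq\mathbb{R}^V$ is the set of all $y\in\mathbb{R}^V$ with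 $y\ge 0$ (componentwise) and $\alpha_e\Sigma(W)(y)+c_e\le\lambda_a$ for each $a\in A$, each edge $e$ starting in $a$, and each $W\in\widehat{\mathcal{W}}$ starting in the end node of $e$. "Piecewise-linear" means piecewise affine-linear. *)

theory Defs
  imports "HOL-Analysis.Analysis" "Graph_Theory.Arc_Walk"
begin

section \<open>Marked networks\<close>

text \<open>The node set \<open>V \<uplus> A\<close> is \<open>verts (graph \<Gamma>)\<close>; \<open>marked \<Gamma>\<close> is \<open>A\<close>, and \<open>gain\<close>, \<open>cost\<close>,
  \<open>marking\<close> are \<open>\<alpha>\<close>, \<open>c\<close>, \<open>\<lambda>\<close>. Only the values of \<open>gain\<close> and \<open>cost\<close> on edges and of
  \<open>marking\<close> on marked nodes matter.\<close>

record ('v, 'e) network =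
  graph :: "('v, 'e) pre_digraph"
  marked :: "'v set"
  gain :: "'e \<Rightarrow> real"
  cost :: "'e \<Rightarrow> real"
  marking :: "'v \<Rightarrow> real"

definition unmarked :: "('v, 'e) network \<Rightarrow> 'v set" where
  "unmarked \<Gamma> = verts (graph \<Gamma>) - marked \<Gamma>"

definition marked_network :: "('v, 'e) network \<Rightarrow> bool" where
  "marked_network \<Gamma> \<longleftrightarrow>
     fin_digraph (graph \<Gamma>) \<and> loopfree_digraph (graph \<Gamma>) \<and>
     marked \<Gamma> \<subseteq> verts (graph \<Gamma>) \<and>
     (\<forall>e\<in>arcs (graph \<Gamma>). gain \<Gamma> e > 0)"

definition all_sinks_marked :: "('v, 'e) network \<Rightarrow> bool" where
  "all_sinks_marked \<Gamma> \<longleftrightarrow>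
     (\<forall>v\<in>verts (graph \<Gamma>). out_arcs (graph \<Gamma>) v = {} \<longrightarrow> v \<in> marked \<Gamma>)"

definition gainy :: "('v, 'e) network \<Rightarrow> bool" where
  "gainy \<Gamma> \<longleftrightarrow> (\<forall>p. pre_digraph.cycle (graph \<Gamma>) p \<longrightarrow> (\<Prod>e\<leftarrow>p. gain \<Gamma> e) < 1)"

text \<open>Points of \<open>\<real>\<^sup>V\<close> are the elements of \<open>unmarked \<Gamma> \<rightarrow>\<^sub>E UNIV\<close>; \<open>node_val \<Gamma> x\<close> extends such a
  point to marked nodes by \<open>x\<^sub>a = \<lambda>\<^sub>a\<close>.\<close>

definition node_val :: "('v, 'e) network \<Rightarrow> ('v \<Rightarrow> real) \<Rightarrow> 'v \<Rightarrow> real" where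
  "node_val \<Gamma> x v = (if v \<in> marked \<Gamma> then marking \<Gamma> v else x v)"

definition O_polyhedron :: "('v, 'e) network \<Rightarrow> ('v \<Rightarrow> real) set" where
  "O_polyhedron \<Gamma> =
     {x \<in> unmarked \<Gamma> \<rightarrow>\<^sub>E UNIV. \<forall>e\<in>arcs (graph \<Gamma>).
        gain \<Gamma> e * node_val \<Gamma> x (head (graph \<Gamma>) e) + cost \<Gamma> e
          \<le> node_val \<Gamma> x (tail (graph \<Gamma>) e)}"

definition transfer_map :: "('v, 'e) network \<Rightarrow> ('v \<Rightarrow> real) \<Rightarrow> ('v \<Rightarrow> real)" where
  "transfer_map \<Gamma> x =
     (\<lambda>v\<in>unmarked \<Gamma>. x v -
        Max ((\<lambda>e. gain \<Gamma> e * node_val \<Gamma> x (head (graph \<Gamma>) e) + cost \<Gamma> e)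
               ` out_arcs (graph \<Gamma>) v))"


section \<open>Walks\<close>

text \<open>A finite walk needs its start node because its edge list may be empty.\<close>

datatype ('v, 'e) walk = Finite_Walk 'v "'e list" | Infinite_Walk "nat \<Rightarrow> 'e"

fun walk_start :: "('v, 'e) network \<Rightarrow> ('v, 'e) walk \<Rightarrow> 'v" where
  "walk_start \<Gamma> (Finite_Walk u p) = u"
| "walk_start \<Gamma> (Infinite_Walk f) = tail (graph \<Gamma>) (f 0)"

text \<open>The set \<open>\<W>\<close>. In the finite case \<open>butlast\<close> of the node list \<open>v\<^sub>1, \<dots>, v\<^sub>r\<^sub>+\<^sub>1\<close>
  is \<open>v\<^sub>1, \<dots>, v\<^sub>r\<close>.\<close>

fun admissible_walk :: "('v, 'e) network \<Rightarrow> ('v, 'e) walk \<Rightarrow> bool" where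
  "admissible_walk \<Gamma> (Finite_Walk u p) \<longleftrightarrow>
     (\<exists>a\<in>marked \<Gamma>. pre_digraph.awalk (graph \<Gamma>) u p a) \<and>
     set (butlast (pre_digraph.awalk_verts (graph \<Gamma>) u p)) \<subseteq> unmarked \<Gamma>"
| "admissible_walk \<Gamma> (Infinite_Walk f) \<longleftrightarrow>
     (\<forall>i. f i \<in> arcs (graph \<Gamma>) \<and> tail (graph \<Gamma>) (f i) \<in> unmarked \<Gamma> \<and>
          head (graph \<Gamma>) (f i) = tail (graph \<Gamma>) (f (Suc i)))"

definition walks :: "('v, 'e) network \<Rightarrow> ('v, 'e) walk set" where
  "walks \<Gamma> = {W. admissible_walk \<Gamma> W}"

text \<open>Indices are shifted to start at 0: the nodes \<open>v\<^sub>1, \<dots>, v\<^sub>r\<close> are the tails of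
  \<open>f 0, \<dots>, f (r - 1)\<close>, and the edges \<open>f s, \<dots>, f (r - 1)\<close> form the repeated cycle.\<close>

definition monocycle :: "('v, 'e) network \<Rightarrow> (nat \<Rightarrow> 'e) \<Rightarrow> bool" where
  "monocycle \<Gamma> f \<longleftrightarrow>
     (\<exists>s r. s < r \<and> inj_on (\<lambda>i. tail (graph \<Gamma>) (f i)) {..<r} \<and>
            (\<forall>i\<ge>s. f (i + (r - s)) = f i))"

fun path_or_monocycle :: "('v, 'e) network \<Rightarrow> ('v, 'e) walk \<Rightarrow> bool" where
  "path_or_monocycle \<Gamma> (Finite_Walk u p) \<longleftrightarrow> (\<exists>v. pre_digraph.apath (graph \<Gamma>) u p v)"
| "path_or_monocycle \<Gamma> (Infinite_Walk f) \<longleftrightarrow> monocycle \<Gamma> f"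

definition simple_walks :: "('v, 'e) network \<Rightarrow> ('v, 'e) walk set" where
  "simple_walks \<Gamma> = {W \<in> walks \<Gamma>. path_or_monocycle \<Gamma> W}"

text \<open>The series in the infinite case converges absolutely in gainy networks.\<close>

fun walk_sum :: "('v, 'e) network \<Rightarrow> ('v, 'e) walk \<Rightarrow> ('v \<Rightarrow> real) \<Rightarrow> real" where
  "walk_sum \<Gamma> (Finite_Walk u p) x =
     (\<Sum>k<length p. (\<Prod>j<k. gain \<Gamma> (p ! j)) *
        (node_val \<Gamma> x (tail (graph \<Gamma>) (p ! k)) + cost \<Gamma> (p ! k))) +
     (\<Prod>j<length p. gain \<Gamma> (p ! j)) * node_val \<Gamma> x (pre_digraph.awlast (graph \<Gamma>) u p)"
| "walk_sum \<Gamma> (Infinite_Walk f) x =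
     (\<Sum>k. (\<Prod>j<k. gain \<Gamma> (f j)) *
        (node_val \<Gamma> x (tail (graph \<Gamma>) (f k)) + cost \<Gamma> (f k)))"

definition C_polyhedron :: "('v, 'e) network \<Rightarrow> ('v \<Rightarrow> real) set" where
  "C_polyhedron \<Gamma> =
     {y \<in> unmarked \<Gamma> \<rightarrow>\<^sub>E UNIV.
        (\<forall>v\<in>unmarked \<Gamma>. 0 \<le> y v) \<and>
        (\<forall>a\<in>marked \<Gamma>. \<forall>e\<in>out_arcs (graph \<Gamma>) a. \<forall>W\<in>simple_walks \<Gamma>.
           walk_start \<Gamma> W = head (graph \<Gamma>) e \<longrightarrow>
           gain \<Gamma> e * walk_sum \<Gamma> W y + cost \<Gamma> e \<le> marking \<Gamma> a)}"


section \<open>Piecewise-linear homeomorphisms\<close>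

text \<open>The library's \<^const>\<open>polyhedron\<close> lives in a Euclidean space type, whereas here \<open>\<real>\<^sup>V\<close> has
  an arbitrary finite (possibly empty) coordinate set. A pair \<open>(a, b)\<close> encodes the
  inequality \<open>\<Sum>v\<in>V. a v * x v \<le> b\<close>.\<close>

definition polyhedron_in :: "'v set \<Rightarrow> ('v \<Rightarrow> real) set \<Rightarrow> bool" where
  "polyhedron_in V P \<longleftrightarrow>
     (\<exists>H. finite H \<and>
        P = {x \<in> V \<rightarrow>\<^sub>E UNIV. \<forall>(a, b)\<in>H. (\<Sum>v\<in>V. a v * x v) \<le> b})"

definition affine_map_on ::
  "'v set \<Rightarrow> ('v \<Rightarrow> real) set \<Rightarrow> (('v \<Rightarrow> real) \<Rightarrow> ('v \<Rightarrow> real)) \<Rightarrow> bool" where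
  "affine_map_on V P f \<longleftrightarrow>
     (\<exists>M b. \<forall>x\<in>P. \<forall>u\<in>V. f x u = (\<Sum>v\<in>V. M u v * x v) + b u)"

definition piecewise_affine_on ::
  "'v set \<Rightarrow> ('v \<Rightarrow> real) set \<Rightarrow> (('v \<Rightarrow> real) \<Rightarrow> ('v \<Rightarrow> real)) \<Rightarrow> bool" where
  "piecewise_affine_on V S f \<longleftrightarrow>
     (\<exists>\<P>. finite \<P> \<and> S = \<Union>\<P> \<and>
        (\<forall>P\<in>\<P>. polyhedron_in V P \<and> affine_map_on V P f))"

definition PL_homeomorphism ::
  "'v set \<Rightarrow> ('v \<Rightarrow> real) set \<Rightarrow> ('v \<Rightarrow> real) set \<Rightarrow>
   (('v \<Rightarrow> real) \<Rightarrow> ('v \<Rightarrow> real)) \<Rightarrow> bool" where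
  "PL_homeomorphism V S T f \<longleftrightarrow>
     (\<exists>g. homeomorphic_maps (subtopology (powertop_real V) S) (subtopology (powertop_real V) T) f g \<and>
          piecewise_affine_on V S f \<and> piecewise_affine_on V T g)"

end

theory Submission
  imports Defs
begin

text \<open>A policy chooses an outgoing edge at every unmarked node; following it from \<open>v\<close> gives a walk in
  \<open>\<W>\<close> that is a path or a monocycle. If \<open>\<phi>(x) = y\<close>, unrolling \<open>x\<^sub>v \<ge> y\<^sub>v + c\<^sub>e + \<alpha>\<^sub>e x\<^sub>w\<close> along a
  simple walk \<open>W\<close> yields \<open>\<Sigma>(W)(y) \<le> x\<^sub>v\<close>, with equality along the policy of maximizing edges. Hence
  the inverse of \<open>\<phi>\<close> sends \<open>y\<close> to the maximum of the finitely many policy values, each affine in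
  \<open>y\<close>; that this maximum solves \<open>\<phi>(x) = y\<close> is policy improvement. The linear pieces on both sides
  are indexed by the policies.\<close>

section \<open>Affine functionals\<close>

text \<open>The identity is required for every function \<open>x\<close>, extensional or not, so
  closure properties need no membership side conditions. It forces \<open>f\<close> to depend only
  on the coordinates in \<open>V\<close>.\<close>

definition affine_functional :: "'v set \<Rightarrow> (('v \<Rightarrow> real) \<Rightarrow> real) \<Rightarrow> bool" where
  "affine_functional V f \<longleftrightarrow> (\<exists>a b. \<forall>x. f x = (\<Sum>v\<in>V. a v * x v) + b)"

lemma affine_functional_const: "affine_functional V (\<lambda>x. c)"
  unfolding affine_functional_def by (rule exI[of _ "\<lambda>_. 0"]) auto

lemma affine_functional_coord:
  assumes "finite V" "v \<in> V"
  shows "affine_functional V (\<lambda>x. x v)"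
proof -
  have "x v = (\<Sum>u\<in>V. (if u = v then 1 else 0) * x u)" for x :: "'a \<Rightarrow> real"
    using assms by (simp add: if_distrib[where f = "\<lambda>c. c * _"] cong: if_cong)
  then show ?thesis
    unfolding affine_functional_def
    by (intro exI[of _ "\<lambda>u. if u = v then 1 else 0"] exI[of _ 0]) simp
qed

lemma affine_functional_add:
  assumes "affine_functional V f" "affine_functional V g"
  shows "affine_functional V (\<lambda>x. f x + g x)"
proof -
  obtain a b a' b' where "\<And>x. f x = (\<Sum>v\<in>V. a v * x v) + b" "\<And>x. g x = (\<Sum>v\<in>V. a' v * x v) + b'"
    using assms unfolding affine_functional_def by blast
  then show ?thesis
    unfolding affine_functional_def
    by (intro exI[of _ "\<lambda>v. a v + a' v"] exI[of _ "b + b'"]) (simp add: distrib_right sum.distrib)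
qed

lemma affine_functional_cmult:
  assumes "affine_functional V f"
  shows "affine_functional V (\<lambda>x. c * f x)"
proof -
  obtain a b where "\<And>x. f x = (\<Sum>v\<in>V. a v * x v) + b"
    using assms unfolding affine_functional_def by blast
  then show ?thesis
    unfolding affine_functional_def
    by (intro exI[of _ "\<lambda>v. c * a v"] exI[of _ "c * b"])
       (simp add: distrib_left sum_distrib_left mult.assoc)
qed

lemma affine_functional_diff:
  assumes "affine_functional V f" "affine_functional V g"
  shows "affine_functional V (\<lambda>x. f x - g x)"
  using affine_functional_add[OF assms(1) affine_functional_cmult[OF assms(2), of "-1"]] by simp

text \<open>Terms are regrouped by coordinate: the coefficient of \<open>y v\<close> is the sum of
  \<open>P k\<close> over all \<open>k\<close> with \<open>u k = v\<close>, which converges by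
  comparison with \<open>P\<close>. Finiteness of \<open>V\<close> allows the exchange of the two
  sums. This treats infinite walks.\<close>

lemma affine_functional_suminf:
  assumes V: "finite V" and u: "\<And>k. u k \<in> V"
    and P: "summable P" and Pc: "summable (\<lambda>k. P k * c k)" and P0: "\<And>k. 0 \<le> P k"
  shows "affine_functional V (\<lambda>y. \<Sum>k. P k * (y (u k) + c k))"
proof -
  define a where "a v k = (if u k = v then P k else 0)" for v k
  have a: "summable (a v)" for v
    by (rule summable_comparison_test'[OF P, of 0]) (auto simp: a_def P0)
  have "(\<Sum>k. P k * (y (u k) + c k)) = (\<Sum>v\<in>V. suminf (a v) * y v) + (\<Sum>k. P k * c k)" for y
  proof -
    have "P k * (y (u k) + c k) = (\<Sum>v\<in>V. a v k * y v) + P k * c k" for k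
      using V u[of k] by (simp add: a_def distrib_left if_distrib[where f = "\<lambda>c. c * _"] cong: if_cong)
    moreover have "summable (\<lambda>k. \<Sum>v\<in>V. a v k * y v)"
      by (intro summable_sum summable_mult2 a)
    moreover have "(\<Sum>k. \<Sum>v\<in>V. a v k * y v) = (\<Sum>v\<in>V. suminf (a v) * y v)"
      by (subst suminf_sum) (auto intro!: summable_mult2 a simp: suminf_mult2[OF a])
    ultimately show ?thesis
      by (simp add: suminf_add[symmetric] Pc)
  qed
  then show ?thesis
    unfolding affine_functional_def by (intro exI[of _ "\<lambda>v. suminf (a v)"]) blast
qed

section \<open>Continuity, polyhedra and affine maps built from affine functionals\<close>

lemma continuous_map_affine_functional:
  assumes "affine_functional V f"
  shows "continuous_map (powertop_real V) euclideanreal f"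
proof -
  obtain a b where f: "f = (\<lambda>x. (\<Sum>v\<in>V. a v * x v) + b)"
    using assms unfolding affine_functional_def by blast
  show ?thesis
  proof (cases "finite V")
    case True
    then show ?thesis
      unfolding f
      by (intro continuous_intros continuous_map_product_projection) auto
  next
    \<comment> \<open>The sum over an infinite set is 0 by convention, so \<open>f\<close> is
      constant.\<close>
    case False
    then show ?thesis by (simp add: f)
  qed
qed

lemma continuous_map_Max:
  fixes f :: "'i \<Rightarrow> 'a \<Rightarrow> real"
  assumes "finite I" "I \<noteq> {}" "\<And>i. i \<in> I \<Longrightarrow> continuous_map X euclideanreal (f i)"
  shows "continuous_map X euclideanreal (\<lambda>x. Max ((\<lambda>i. f i x) ` I))"
  using assms
proof (induction I rule: finite_ne_induct)
  case (insert i I)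
  then have "continuous_map X euclideanreal (\<lambda>x. max (f i x) (Max ((\<lambda>i. f i x) ` I)))"
    by (intro continuous_map_real_max) auto
  then show ?case using insert by simp
qed simp

lemma polyhedron_inI:
  fixes f g :: "'i \<Rightarrow> ('v \<Rightarrow> real) \<Rightarrow> real"
  assumes "finite I" "\<And>i. i \<in> I \<Longrightarrow> affine_functional V (f i)"
    "\<And>i. i \<in> I \<Longrightarrow> affine_functional V (g i)"
  shows "polyhedron_in V {x \<in> V \<rightarrow>\<^sub>E UNIV. \<forall>i\<in>I. f i x \<le> g i x}"
proof -
  have "\<exists>a b. \<forall>x. f i x - g i x = (\<Sum>v\<in>V. a v * x v) + b" if "i \<in> I" for i
    using affine_functional_diff[OF assms(2,3)[OF that]] unfolding affine_functional_def .
  then obtain a b where ab: "\<And>i x. i \<in> I \<Longrightarrow> f i x - g i x = (\<Sum>v\<in>V. a i v * x v) + b i"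
    by metis
  have "f i x \<le> g i x \<longleftrightarrow> (\<Sum>v\<in>V. a i v * x v) \<le> - b i" if "i \<in> I" for i x
    using ab[OF that, of x] by linarith
  then have "{x \<in> V \<rightarrow>\<^sub>E UNIV. \<forall>i\<in>I. f i x \<le> g i x}
      = {x \<in> V \<rightarrow>\<^sub>E UNIV. \<forall>(a, b)\<in>(\<lambda>i. (a i, - b i)) ` I. (\<Sum>v\<in>V. a v * x v) \<le> b}"
    by auto
  then show ?thesis
    unfolding polyhedron_in_def using \<open>finite I\<close>
    by (intro exI[of _ "(\<lambda>i. (a i, - b i)) ` I"] conjI) auto
qed

lemma polyhedron_in_Int:
  assumes "polyhedron_in V P" "polyhedron_in V Q"
  shows "polyhedron_in V (P \<inter> Q)"
proof -
  obtain H K where "finite H" "P = {x \<in> V \<rightarrow>\<^sub>E UNIV. \<forall>(a, b)\<in>H. (\<Sum>v\<in>V. a v * x v) \<le> b}"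
    and "finite K" "Q = {x \<in> V \<rightarrow>\<^sub>E UNIV. \<forall>(a, b)\<in>K. (\<Sum>v\<in>V. a v * x v) \<le> b}"
    using assms unfolding polyhedron_in_def by blast
  then show ?thesis
    unfolding polyhedron_in_def by (intro exI[of _ "H \<union> K"]) auto
qed

lemma affine_map_onI:
  assumes "\<And>u. u \<in> V \<Longrightarrow> affine_functional V (h u)"
    and "\<And>x u. x \<in> P \<Longrightarrow> u \<in> V \<Longrightarrow> f x u = h u x"
  shows "affine_map_on V P f"
proof -
  have "\<exists>a b. \<forall>x. h u x = (\<Sum>v\<in>V. a v * x v) + b" if "u \<in> V" for u
    using assms(1)[OF that] unfolding affine_functional_def .
  then obtain a b where "\<And>u x. u \<in> V \<Longrightarrow> h u x = (\<Sum>v\<in>V. a u v * x v) + b u"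
    by metis
  then show ?thesis
    unfolding affine_map_on_def using assms(2) by (intro exI[of _ a] exI[of _ b]) simp
qed


section \<open>Walk sums\<close>

text \<open>After dropping the first \<open>s\<close> terms, let \<open>B\<close> be the sum of the
  first \<open>p\<close> terms and \<open>S n\<close> the partial sums. Nonnegativity and the
  scaling by \<open>q\<close> give \<open>S n \<le> S (p + n) = B + q * S n\<close>, hence the
  uniform bound \<open>S n \<le> B / (1 - q)\<close>.\<close>

lemma summable_periodic_factor:
  fixes f :: "nat \<Rightarrow> real"
  assumes nn: "\<And>k. 0 \<le> f k" and q: "0 \<le> q" "q < 1"
    and per: "\<And>k. s \<le> k \<Longrightarrow> f (k + p) = q * f k"
  shows "summable f"
proof -
  define h where "h k = f (k + s)" for k
  have h: "h (k + p) = q * h k" "0 \<le> h k" for k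
    using per[of "k + s"] nn by (auto simp: h_def add_ac)
  have "(\<Sum>k<n. h k) \<le> (\<Sum>k<p. h k) / (1 - q)" for n
  proof -
    have "(\<Sum>k<n. h k) \<le> (\<Sum>k<p + n. h k)"
      by (rule sum_mono2) (auto simp: h)
    also have "\<dots> = (\<Sum>k<p. h k) + (\<Sum>k<n. h (k + p))"
      by (induction n) (auto simp: add.commute add.left_commute)
    also have "\<dots> = (\<Sum>k<p. h k) + q * (\<Sum>k<n. h k)"
      by (simp add: h sum_distrib_left)
    finally show ?thesis using q by (simp add: field_simps)
  qed
  then have "summable h"
    by (intro summableI_nonneg_bounded[where x = "(\<Sum>k<p. h k) / (1 - q)"]) (auto simp: h)
  then show ?thesis unfolding h_def by (simp add: summable_iff_shift)
qed

text \<open>Translates indexed sequences of nodes and edges into list walks. The free lower index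
  \<open>m\<close> allows cutting out the repeated cycle of a monocycle as well as an initial
  segment.\<close>

lemma (in wf_digraph) awalk_of_seq:
  assumes "m \<le> n" "nd m \<in> verts G"
    and "\<And>i. m \<le> i \<Longrightarrow> i < n \<Longrightarrow> f i \<in> arcs G \<and> tail G (f i) = nd i \<and> head G (f i) = nd (Suc i)"
  shows "awalk (nd m) (map f [m..<n]) (nd n) \<and>
    awalk_verts (nd m) (map f [m..<n]) = map nd [m..<Suc n]"
  using assms
proof (induction n rule: dec_induct)
  case base
  then show ?case by (simp add: awalk_simps)
next
  case (step n)
  then have IH: "awalk (nd m) (map f [m..<n]) (nd n)"
    "awalk_verts (nd m) (map f [m..<n]) = map nd [m..<Suc n]"
    by auto
  have e: "awalk (nd n) [f n] (nd (Suc n))" "tail G (f n) = nd n" "head G (f n) = nd (Suc n)"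
    using step.prems(2)[of n] step.hyps by (auto simp: awalk_simps dest: tail_in_verts head_in_verts)
  then have a: "awalk (nd m) (map f [m..<n] @ [f n]) (nd (Suc n))"
    using IH(1) by (intro awalk_appendI)
  have "awalk_verts (nd m) (map f [m..<n] @ [f n]) = map nd [m..<n] @ [nd n, nd (Suc n)]"
    using step.prems step.hyps e by (simp add: awalk_verts_conv)
  then show ?case using a step.hyps by simp
qed

fun walk_arcs :: "('v, 'e) walk \<Rightarrow> 'e set" where
  "walk_arcs (Finite_Walk u p) = set p"
| "walk_arcs (Infinite_Walk f) = range f"

text \<open>The last assumption is the hypothesis on sinks in its working form: the maximum in the
  transfer map ranges over a nonempty set, and a policy exists.\<close>

locale gainy_network = fin_digraph "graph \<Gamma>" for \<Gamma> :: "('v, 'e) network" +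
  assumes marked_subset: "marked \<Gamma> \<subseteq> verts (graph \<Gamma>)"
    and gain_pos: "e \<in> arcs (graph \<Gamma>) \<Longrightarrow> gain \<Gamma> e > 0"
    and cycle_gain: "cycle p \<Longrightarrow> (\<Prod>e\<leftarrow>p. gain \<Gamma> e) < 1"
    and out_arcs_unmarked: "v \<in> unmarked \<Gamma> \<Longrightarrow> out_arcs (graph \<Gamma>) v \<noteq> {}"
begin

abbreviation "G \<equiv> graph \<Gamma>"
abbreviation "V \<equiv> unmarked \<Gamma>"
abbreviation "nv \<equiv> node_val \<Gamma>"

lemma finite_V [simp]: "finite V"
  by (simp add: unmarked_def)

lemma V_D: "v \<in> V \<Longrightarrow> v \<in> verts G \<and> v \<notin> marked \<Gamma>"
  by (simp add: unmarked_def)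

lemma nv_V [simp]: "v \<in> V \<Longrightarrow> nv x v = x v"
  by (simp add: node_val_def V_D)

lemma verts_cases: "v \<in> verts G \<Longrightarrow> v \<in> V \<or> v \<in> marked \<Gamma>"
  by (auto simp: unmarked_def)

lemma affine_functional_nv: "v \<in> verts G \<Longrightarrow> affine_functional V (\<lambda>x. nv x v)"
  by (cases "v \<in> marked \<Gamma>")
     (auto simp: node_val_def unmarked_def intro!: affine_functional_const affine_functional_coord)

text \<open>Turns the closed formula into a recursion for inductions on finite walks. The start node
  \<open>u\<close> disappears on the right because the nodes of a nonempty walk are read off its
  edges.\<close>

lemma walk_sum_Cons:
  "walk_sum \<Gamma> (Finite_Walk u (e # p)) y =
     nv y (tail G e) + cost \<Gamma> e + gain \<Gamma> e * walk_sum \<Gamma> (Finite_Walk (head G e) p) y"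
  by (simp add: sum.lessThan_Suc_shift prod.lessThan_Suc_shift sum_distrib_left mult.assoc
      distrib_left del: sum.lessThan_Suc prod.lessThan_Suc)

lemma admissible_ConsD:
  assumes "admissible_walk \<Gamma> (Finite_Walk u (e # p))"
  shows "e \<in> arcs G" "u = tail G e" "tail G e \<in> V" "admissible_walk \<Gamma> (Finite_Walk (head G e) p)"
  using assms by (auto simp: awalk_Cons_iff)

text \<open>Gaininess enters here. From index \<open>s\<close> on, advancing by the cycle length
  \<open>r - s\<close> multiplies the gain product by the weight \<open>q < 1\<close> of the
  repeated cycle, so the products decay geometrically block by block.\<close>

lemma monocycle_summable_gain:
  assumes "admissible_walk \<Gamma> (Infinite_Walk f)" "monocycle \<Gamma> f"
  shows "summable (\<lambda>k. \<Prod>j<k. gain \<Gamma> (f j))"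
proof -
  have f: "f i \<in> arcs G" "head G (f i) = tail G (f (Suc i))" for i
    using assms(1) by auto
  obtain s r where "s < r" and inj: "inj_on (\<lambda>i. tail G (f i)) {..<r}"
    and per: "\<And>i. i \<ge> s \<Longrightarrow> f (i + (r - s)) = f i"
    using assms(2) unfolding monocycle_def by blast
  define p where "p = map f [s..<r]"
  have "f r = f s" using per[of s] \<open>s < r\<close> by simp
  have "awalk (tail G (f s)) p (tail G (f r)) \<and>
      awalk_verts (tail G (f s)) p = map (\<lambda>i. tail G (f i)) [s..<Suc r]"
    unfolding p_def using \<open>s < r\<close> f by (intro awalk_of_seq) auto
  then have p: "awalk (tail G (f s)) p (tail G (f s))"
    "tl (awalk_verts (tail G (f s)) p) = map (\<lambda>i. tail G (f i)) ([Suc s..<r] @ [s])"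
    using \<open>s < r\<close> \<open>f r = f s\<close> by (simp_all add: upt_conv_Cons)
  \<comment> \<open>\<open>cycle\<close> demands distinctness of the node list without its first
    entry. Replacing the closing index \<open>r\<close> by \<open>s\<close> leaves only indices
    below \<open>r\<close>, where injectivity is known.\<close>
  have "distinct (map (\<lambda>i. tail G (f i)) ([Suc s..<r] @ [s]))"
    unfolding distinct_map using \<open>s < r\<close> by (auto intro: inj_on_subset[OF inj] dest: inj_onD[OF inj])
  then have "cycle p"
    unfolding cycle_def using p \<open>s < r\<close> by (auto simp: p_def)
  define q where "q = (\<Prod>j\<in>{s..<r}. gain \<Gamma> (f j))"
  have "q = (\<Prod>e\<leftarrow>p. gain \<Gamma> e)"
    using prod.distinct_set_conv_list[of "[s..<r]" "\<lambda>j. gain \<Gamma> (f j)"]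
    by (simp add: q_def p_def o_def)
  then have "q < 1" using cycle_gain[OF \<open>cycle p\<close>] by simp
  moreover have "0 \<le> q"
    using f gain_pos unfolding q_def by (intro prod_nonneg) (auto intro: less_imp_le)
  ultimately have q: "0 \<le> q" "q < 1" by auto
  show ?thesis
  proof (rule summable_periodic_factor[OF _ q])
    show "0 \<le> (\<Prod>j<k. gain \<Gamma> (f j))" for k
      using f gain_pos by (intro prod_nonneg) (auto intro: less_imp_le)
    show "(\<Prod>j<k + (r - s). gain \<Gamma> (f j)) = q * (\<Prod>j<k. gain \<Gamma> (f j))" if "s \<le> k" for k
      using that
    proof (induction k rule: dec_induct)
      case base
      have "{..<r} = {s..<r} \<union> {..<s}" "{s..<r} \<inter> {..<s} = {}" using \<open>s < r\<close> by auto
      then show ?case using \<open>s < r\<close> by (simp add: q_def prod.union_disjoint)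
    next
      case (step k)
      then show ?case using per[of k] by simp
    qed
  qed
qed

lemma bounded_along_walk:
  assumes "admissible_walk \<Gamma> (Infinite_Walk f)"
  shows "\<exists>B. \<forall>k. \<bar>h (f k)\<bar> \<le> (B :: real)"
proof -
  have "range f \<subseteq> arcs G" using assms by auto
  then have "finite (range (\<lambda>k. \<bar>h (f k)\<bar>))"
    using finite_subset[OF _ finite_arcs]
    by (metis finite_imageI image_image)
  then show ?thesis
    by (intro exI[of _ "Max (range (\<lambda>k. \<bar>h (f k)\<bar>))"]) auto
qed

text \<open>The edge set is finite, so \<open>h\<close> is bounded along the walk and the gain
  products dominate. Leaving \<open>h\<close> arbitrary covers the costs, the terms of \<Sigma>(W)
  and the remainder terms alike.\<close>

lemma summable_walk_terms:
  assumes "admissible_walk \<Gamma> (Infinite_Walk f)" "monocycle \<Gamma> f"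
  shows "summable (\<lambda>k. (\<Prod>j<k. gain \<Gamma> (f j)) * h (f k))"
proof -
  obtain B where B: "\<And>k. \<bar>h (f k)\<bar> \<le> B" using bounded_along_walk[OF assms(1)] by metis
  have f: "f i \<in> arcs G" for i using assms(1) by auto
  have P: "0 \<le> (\<Prod>j<k. gain \<Gamma> (f j))" for k
    using f gain_pos by (intro prod_nonneg) (auto intro: less_imp_le)
  show ?thesis
  proof (rule summable_comparison_test')
    show "summable (\<lambda>k. (\<Prod>j<k. gain \<Gamma> (f j)) * B)"
      using monocycle_summable_gain[OF assms] by (rule summable_mult2)
    show "norm ((\<Prod>j<k. gain \<Gamma> (f j)) * h (f k)) \<le> (\<Prod>j<k. gain \<Gamma> (f j)) * B" for k
      using P[of k] B[of k] by (auto simp: abs_mult intro!: mult_left_mono)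
  qed
qed

lemma simple_walksD:
  assumes "W \<in> simple_walks \<Gamma>"
  shows "admissible_walk \<Gamma> W" "path_or_monocycle \<Gamma> W"
  using assms by (auto simp: simple_walks_def walks_def)

text \<open>Infinite counterpart of \<open>walk_sum_Cons\<close>. Splitting off the first term and
  pulling out its gain needs convergence of both series, which the two assumptions provide.\<close>

lemma walk_sum_shift:
  assumes "Infinite_Walk f \<in> simple_walks \<Gamma>" "Infinite_Walk (\<lambda>k. f (Suc k)) \<in> simple_walks \<Gamma>"
  shows "walk_sum \<Gamma> (Infinite_Walk f) y = nv y (tail G (f 0)) + cost \<Gamma> (f 0) +
    gain \<Gamma> (f 0) * walk_sum \<Gamma> (Infinite_Walk (\<lambda>k. f (Suc k))) y"
proof -
  define h where "h e = nv y (tail G e) + cost \<Gamma> e" for e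
  have 1: "summable (\<lambda>k. (\<Prod>j<k. gain \<Gamma> (f j)) * h (f k))"
    using simple_walksD[OF assms(1)] by (intro summable_walk_terms) auto
  have 2: "summable (\<lambda>k. (\<Prod>j<k. gain \<Gamma> (f (Suc j))) * h (f (Suc k)))"
    using simple_walksD[OF assms(2)] summable_walk_terms[of "\<lambda>k. f (Suc k)" h] by auto
  have "(\<Sum>k. (\<Prod>j<Suc k. gain \<Gamma> (f j)) * h (f (Suc k))) =
      gain \<Gamma> (f 0) * (\<Sum>k. (\<Prod>j<k. gain \<Gamma> (f (Suc j))) * h (f (Suc k)))"
    by (simp add: suminf_mult[OF 2, symmetric] prod.lessThan_Suc_shift mult.assoc
        del: prod.lessThan_Suc)
  then show ?thesis
    using suminf_split_head[OF 1] by (simp add: h_def)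
qed

lemma affine_functional_walk_sum:
  assumes "W \<in> simple_walks \<Gamma>"
  shows "affine_functional V (walk_sum \<Gamma> W)"
proof (cases W)
  case (Finite_Walk u p)
  have "admissible_walk \<Gamma> (Finite_Walk u p) \<Longrightarrow> affine_functional V (\<lambda>y. walk_sum \<Gamma> (Finite_Walk u p) y)"
  proof (induction p arbitrary: u)
    case Nil
    then show ?case by (auto simp: awalk_Nil_iff intro: affine_functional_nv)
  next
    case (Cons e p)
    note D = admissible_ConsD[OF Cons.prems]
    show ?case
      unfolding walk_sum_Cons
      by (intro affine_functional_add affine_functional_cmult affine_functional_const
          affine_functional_nv Cons.IH D) (use D in auto)
  qed
  then show ?thesis using simple_walksD(1)[OF assms] unfolding Finite_Walk by iprover
next
  case (Infinite_Walk f)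
  then have f: "admissible_walk \<Gamma> (Infinite_Walk f)" "monocycle \<Gamma> f"
    using simple_walksD[OF assms] by auto
  then have f': "f i \<in> arcs G" "tail G (f i) \<in> V" for i by auto
  have "affine_functional V (\<lambda>y. \<Sum>k. (\<Prod>j<k. gain \<Gamma> (f j)) * (y (tail G (f k)) + cost \<Gamma> (f k)))"
    using f f' gain_pos
    by (intro affine_functional_suminf monocycle_summable_gain summable_walk_terms prod_nonneg)
       (auto intro: less_imp_le)
  moreover have "walk_sum \<Gamma> W =
      (\<lambda>y. \<Sum>k. (\<Prod>j<k. gain \<Gamma> (f j)) * (y (tail G (f k)) + cost \<Gamma> (f k)))"
    using f' by (simp add: fun_eq_iff Infinite_Walk)
  ultimately show ?thesis by simp
qed

text \<open>The sign \<open>s\<close> covers super- and subsolutions at once.\<close>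

lemma walk_sum_bound:
  assumes W: "W \<in> simple_walks \<Gamma>"
    and le: "\<And>e. e \<in> walk_arcs W \<Longrightarrow>
      s * (y (tail G e) + cost \<Gamma> e + gain \<Gamma> e * nv x (head G e)) \<le> s * x (tail G e)"
  shows "s * walk_sum \<Gamma> W y \<le> s * nv x (walk_start \<Gamma> W)"
proof (cases W)
  case (Finite_Walk u p)
  have "admissible_walk \<Gamma> (Finite_Walk u p) \<Longrightarrow> set p \<subseteq> walk_arcs W \<Longrightarrow>
      s * walk_sum \<Gamma> (Finite_Walk u p) y \<le> s * nv x u"
  proof (induction p arbitrary: u)
    case Nil
    then show ?case by (auto simp: awalk_Nil_iff node_val_def)
  next
    case (Cons e p)
    note D = admissible_ConsD[OF Cons.prems(1)]
    have "s * walk_sum \<Gamma> (Finite_Walk (head G e) p) y \<le> s * nv x (head G e)"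
      using Cons.IH[OF D(4)] Cons.prems(2) by simp
    then have "gain \<Gamma> e * (s * walk_sum \<Gamma> (Finite_Walk (head G e) p) y) \<le> gain \<Gamma> e * (s * nv x (head G e))"
      using gain_pos[OF D(1)] by simp
    then show ?case
      using le[of e] Cons.prems(2) D unfolding walk_sum_Cons by (simp add: algebra_simps)
  qed
  then show ?thesis using simple_walksD[OF W] Finite_Walk by simp
next
  case (Infinite_Walk f)
  then have f: "admissible_walk \<Gamma> (Infinite_Walk f)" "monocycle \<Gamma> f"
    using simple_walksD[OF W] by auto
  then have f': "f i \<in> arcs G" "tail G (f i) \<in> V" "head G (f i) = tail G (f (Suc i))" for i by auto
  define P where "P k = (\<Prod>j<k. gain \<Gamma> (f j))" for k
  have P: "0 \<le> P k" "P (Suc k) = P k * gain \<Gamma> (f k)" for k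
    using f' gain_pos unfolding P_def by (auto intro!: prod_nonneg intro: less_imp_le)
  \<comment> \<open>\<open>S n\<close> follows the walk for \<open>n\<close> edges and replaces the
    rest by the value of \<open>x\<close> at the node reached. The edge inequalities make
    \<open>s * S n\<close> nonincreasing, and the remainder term tends to 0 because it is the
    general term of a convergent series.\<close>
  define S where "S n = (\<Sum>k<n. P k * (y (tail G (f k)) + cost \<Gamma> (f k))) + P n * x (tail G (f n))" for n
  have "s * S n \<le> s * x (tail G (f 0))" for n
  proof (induction n)
    case 0
    then show ?case by (simp add: S_def P_def)
  next
    case (Suc n)
    have "s * (y (tail G (f n)) + cost \<Gamma> (f n) + gain \<Gamma> (f n) * x (tail G (f (Suc n)))) \<le> s * x (tail G (f n))"
      using le[of "f n"] f' Infinite_Walk by simp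
    from mult_left_mono[OF this P(1)[of n]] have "s * S (Suc n) \<le> s * S n"
      unfolding S_def by (simp add: P algebra_simps)
    then show ?case using Suc by simp
  qed
  moreover have "S \<longlonglongrightarrow> walk_sum \<Gamma> W y + 0"
    unfolding S_def
  proof (intro tendsto_add)
    show "(\<lambda>n. \<Sum>k<n. P k * (y (tail G (f k)) + cost \<Gamma> (f k))) \<longlonglongrightarrow> walk_sum \<Gamma> W y"
      using summable_LIMSEQ[OF summable_walk_terms[OF f, where h = "\<lambda>e. y (tail G e) + cost \<Gamma> e"]] f'
      by (simp add: Infinite_Walk P_def)
    show "(\<lambda>n. P n * x (tail G (f n))) \<longlonglongrightarrow> 0"
      using summable_LIMSEQ_zero[OF summable_walk_terms[OF f, where h = "\<lambda>e. x (tail G e)"]]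
      by (simp add: P_def)
  qed
  ultimately have "s * walk_sum \<Gamma> W y \<le> s * x (tail G (f 0))"
    by (intro LIMSEQ_le_const2[OF tendsto_mult_left[of S]]) auto
  then show ?thesis using f' by (simp add: Infinite_Walk)
qed


section \<open>Policies\<close>

text \<open>Extensionality keeps this set finite, so that maxima over policies exist.\<close>

definition policies :: "('v \<Rightarrow> 'e) set" where
  "policies = (\<Pi>\<^sub>E v\<in>V. out_arcs G v)"

text \<open>Beyond the first marked node \<open>step_node\<close> depends on the junk value of \<open>\<sigma>\<close> there.\<close>

definition step_node :: "('v \<Rightarrow> 'e) \<Rightarrow> 'v \<Rightarrow> nat \<Rightarrow> 'v" where
  "step_node \<sigma> v k = ((\<lambda>u. head G (\<sigma> u)) ^^ k) v"

definition policy_walk :: "('v \<Rightarrow> 'e) \<Rightarrow> 'v \<Rightarrow> ('v, 'e) walk" where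
  "policy_walk \<sigma> v =
    (if \<exists>k. step_node \<sigma> v k \<in> marked \<Gamma>
     then Finite_Walk v (map (\<lambda>k. \<sigma> (step_node \<sigma> v k)) [0..<LEAST k. step_node \<sigma> v k \<in> marked \<Gamma>])
     else Infinite_Walk (\<lambda>k. \<sigma> (step_node \<sigma> v k)))"

definition policy_val :: "('v \<Rightarrow> 'e) \<Rightarrow> ('v \<Rightarrow> real) \<Rightarrow> 'v \<Rightarrow> real" where
  "policy_val \<sigma> y v = walk_sum \<Gamma> (policy_walk \<sigma> v) y"

text \<open>The maximum is taken at each node separately; that a single policy attains it at all
  nodes at once is a consequence of the optimality equation.\<close>

definition best_val :: "('v \<Rightarrow> real) \<Rightarrow> 'v \<Rightarrow> real" where
  "best_val y v = Max ((\<lambda>\<sigma>. policy_val \<sigma> y v) ` policies)"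

definition arc_val :: "('v \<Rightarrow> real) \<Rightarrow> 'e \<Rightarrow> real" where
  "arc_val x e = gain \<Gamma> e * nv x (head G e) + cost \<Gamma> e"

definition max_val :: "('v \<Rightarrow> real) \<Rightarrow> 'v \<Rightarrow> real" where
  "max_val x v = Max (arc_val x ` out_arcs G v)"

lemma finite_out_arcs [simp]: "finite (out_arcs G v)"
  by (rule finite_subset[OF _ finite_arcs]) (auto simp: out_arcs_def)

lemma finite_policies [simp]: "finite policies"
  unfolding policies_def by (intro finite_PiE) auto

lemma policies_nonempty [simp]: "policies \<noteq> {}"
  unfolding policies_def using out_arcs_unmarked by (auto simp: PiE_eq_empty_iff)

lemma policyD:
  assumes "\<sigma> \<in> policies" "v \<in> V"
  shows "\<sigma> v \<in> arcs G" "tail G (\<sigma> v) = v" "head G (\<sigma> v) \<in> verts G" "\<sigma> v \<in> out_arcs G v"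
proof -
  show "\<sigma> v \<in> out_arcs G v" using assms by (auto simp: policies_def)
  then show "\<sigma> v \<in> arcs G" "tail G (\<sigma> v) = v" "head G (\<sigma> v) \<in> verts G" by auto
qed

lemma step_node_0 [simp]: "step_node \<sigma> v 0 = v"
  by (simp add: step_node_def)

lemma step_node_Suc: "step_node \<sigma> v (Suc k) = head G (\<sigma> (step_node \<sigma> v k))"
  by (simp add: step_node_def)

lemma step_node_Suc': "step_node \<sigma> v (Suc k) = step_node \<sigma> (head G (\<sigma> v)) k"
  by (simp only: step_node_def funpow_Suc_right comp_apply)

lemma step_node_add: "step_node \<sigma> v (k + t) = step_node \<sigma> (step_node \<sigma> v k) t"
  by (simp add: step_node_def funpow_add add.commute[of k])

lemma step_node_verts:
  assumes "\<sigma> \<in> policies" "v \<in> verts G" "\<And>i. i < k \<Longrightarrow> step_node \<sigma> v i \<notin> marked \<Gamma>"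
  shows "step_node \<sigma> v k \<in> verts G"
  using assms(3)
proof (induction k)
  case (Suc k)
  then have "step_node \<sigma> v k \<in> V" by (auto simp: unmarked_def)
  then show ?case using policyD[OF assms(1)] by (simp add: step_node_Suc)
qed (simp add: assms)

text \<open>Each node determines the next one. A repetition before the first marked node would
  therefore keep the walk from ever reaching it, and if no marked node is reached, the first
  repetition closes a cycle that is repeated forever.\<close>

lemma policy_walk_simple:
  assumes \<sigma>: "\<sigma> \<in> policies" and v: "v \<in> verts G"
  shows "policy_walk \<sigma> v \<in> simple_walks \<Gamma> \<and> walk_start \<Gamma> (policy_walk \<sigma> v) = v \<and>
    walk_arcs (policy_walk \<sigma> v) \<subseteq> \<sigma> ` V"
proof (cases "\<exists>k. step_node \<sigma> v k \<in> marked \<Gamma>")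
  case True
  define n where "n = (LEAST k. step_node \<sigma> v k \<in> marked \<Gamma>)"
  define p where "p = map (\<lambda>k. \<sigma> (step_node \<sigma> v k)) [0..<n]"
  have W: "policy_walk \<sigma> v = Finite_Walk v p"
    using True by (simp add: policy_walk_def n_def p_def)
  have n: "step_node \<sigma> v n \<in> marked \<Gamma>"
    using LeastI_ex[OF True] by (simp add: n_def)
  have less: "step_node \<sigma> v i \<notin> marked \<Gamma>" if "i < n" for i
    using that not_less_Least unfolding n_def by blast
  then have V: "step_node \<sigma> v i \<in> V" if "i < n" for i
    using that step_node_verts[OF \<sigma> v, of i] by (auto simp: unmarked_def)
  have p: "awalk v p (step_node \<sigma> v n)" "awalk_verts v p = map (step_node \<sigma> v) [0..<Suc n]"
    using awalk_of_seq[of 0 n "step_node \<sigma> v" "\<lambda>k. \<sigma> (step_node \<sigma> v k)"] v policyD[OF \<sigma> V]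
    by (simp_all add: p_def step_node_Suc)
  have "inj_on (step_node \<sigma> v) {0..<Suc n}"
  proof (rule linorder_inj_onI)
    fix i j assume "i < j" and j: "j \<in> {0..<Suc n}"
    show "step_node \<sigma> v i \<noteq> step_node \<sigma> v j"
    proof
      assume "step_node \<sigma> v i = step_node \<sigma> v j"
      \<comment> \<open>Advancing both indices by \<open>n - j\<close> moves the coincidence to
        index \<open>n\<close> and an index below \<open>n\<close>, whose node would then be marked,
        contradicting the minimality of \<open>n\<close>.\<close>
      then have "step_node \<sigma> v (i + (n - j)) = step_node \<sigma> v (j + (n - j))"
        by (simp only: step_node_add)
      moreover have "i + (n - j) < n" "j + (n - j) = n" using \<open>i < j\<close> j by auto
      ultimately show False using n less[of "i + (n - j)"] by simp
    qed
  qed auto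
  then have "apath v p (step_node \<sigma> v n)"
    using p by (simp add: apath_def distinct_map del: upt_Suc)
  moreover have "set (butlast (awalk_verts v p)) \<subseteq> V"
    using V by (auto simp: p(2))
  ultimately show ?thesis
    using n p(1) V by (auto simp: W simple_walks_def walks_def p_def)
next
  case False
  let ?f = "\<lambda>k. \<sigma> (step_node \<sigma> v k)"
  have V: "step_node \<sigma> v k \<in> V" for k
    using False step_node_verts[OF \<sigma> v, of k] by (auto simp: unmarked_def)
  have ex: "\<exists>r. \<exists>s<r. step_node \<sigma> v s = step_node \<sigma> v r"
  proof (rule ccontr)
    assume "\<not> ?thesis"
    then have "inj (step_node \<sigma> v)" by (metis injI linorder_neqE_nat)
    moreover have "finite (range (step_node \<sigma> v))"
      by (rule finite_subset[OF _ finite_V]) (use V in auto)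
    ultimately show False using finite_imageD by blast
  qed
  \<comment> \<open>\<open>r\<close> is the first index whose node occurred before, so the nodes
    below \<open>r\<close> are distinct; \<open>s\<close> is the earlier occurrence and starts the
    cycle.\<close>
  define r where "r = (LEAST r. \<exists>s<r. step_node \<sigma> v s = step_node \<sigma> v r)"
  obtain s where s: "s < r" "step_node \<sigma> v s = step_node \<sigma> v r"
    using LeastI_ex[OF ex] by (auto simp: r_def)
  have "inj_on (step_node \<sigma> v) {..<r}"
  proof (rule linorder_inj_onI)
    fix i j assume "i < j" and j: "j \<in> {..<r}"
    then show "step_node \<sigma> v i \<noteq> step_node \<sigma> v j"
      using not_less_Least[of j] unfolding r_def by auto
  qed auto
  moreover have "step_node \<sigma> v (i + (r - s)) = step_node \<sigma> v i" if "s \<le> i" for i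
  proof -
    have "step_node \<sigma> v (i + (r - s)) = step_node \<sigma> v (r + (i - s))"
      using that s(1) by (simp add: add.commute)
    also have "\<dots> = step_node \<sigma> v (s + (i - s))" by (simp only: step_node_add s)
    finally show ?thesis using that by simp
  qed
  ultimately have "monocycle \<Gamma> ?f"
    unfolding monocycle_def using s policyD[OF \<sigma> V] by (intro exI[of _ s] exI[of _ r]) simp
  moreover have W: "policy_walk \<sigma> v = Infinite_Walk ?f"
    using False by (simp add: policy_walk_def)
  moreover have "admissible_walk \<Gamma> (Infinite_Walk ?f)"
    using V policyD[OF \<sigma> V] by (simp add: step_node_Suc[symmetric])
  ultimately show ?thesis
    using V policyD[OF \<sigma> V, of 0] by (auto simp: simple_walks_def walks_def)
qed

text \<open>The least index is 0 and the walk is empty. Hence policy values already carry the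
  marking, and \<open>node_val\<close> leaves them unchanged.\<close>

lemma policy_val_marked [simp]: "v \<in> marked \<Gamma> \<Longrightarrow> policy_val \<sigma> y v = marking \<Gamma> v"
proof -
  assume "v \<in> marked \<Gamma>"
  moreover from this have "(LEAST k. step_node \<sigma> v k \<in> marked \<Gamma>) = 0" by (intro Least_equality) auto
  moreover have "\<exists>k. step_node \<sigma> v k \<in> marked \<Gamma>"
    using \<open>v \<in> marked \<Gamma>\<close> by (intro exI[of _ 0]) simp
  ultimately show ?thesis by (simp add: policy_val_def policy_walk_def node_val_def)
qed

lemma nv_policy_val [simp]: "nv (policy_val \<sigma> y) v = policy_val \<sigma> y v"
  by (simp add: node_val_def)

text \<open>The walk from \<open>v\<close> is the edge \<open>\<sigma> v\<close> followed by the
  policy walk from its head, so the recursions for finite and infinite walk sums apply.\<close>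

lemma policy_val_rec:
  assumes \<sigma>: "\<sigma> \<in> policies" and v: "v \<in> V"
  shows "policy_val \<sigma> y v = y v + arc_val (policy_val \<sigma> y) (\<sigma> v)"
proof -
  note D = policyD[OF \<sigma> v]
  let ?w = "head G (\<sigma> v)"
  have "v \<notin> marked \<Gamma>" using V_D[OF v] by simp
  have "walk_sum \<Gamma> (policy_walk \<sigma> v) y = y v + cost \<Gamma> (\<sigma> v) + gain \<Gamma> (\<sigma> v) * walk_sum \<Gamma> (policy_walk \<sigma> ?w) y"
  proof (cases "\<exists>k. step_node \<sigma> v k \<in> marked \<Gamma>")
    case True
    then obtain k where "step_node \<sigma> v k \<in> marked \<Gamma>" by blast
    with \<open>v \<notin> marked \<Gamma>\<close> have w: "\<exists>k. step_node \<sigma> ?w k \<in> marked \<Gamma>"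
      by (cases k) (auto simp: step_node_Suc')
    \<comment> \<open>Index 0 does not qualify because \<open>v\<close> is unmarked, so the walk
      from \<open>?w\<close> is shorter by exactly one edge.\<close>
    have "(LEAST k. step_node \<sigma> v k \<in> marked \<Gamma>) = Suc (LEAST k. step_node \<sigma> v (Suc k) \<in> marked \<Gamma>)"
      using \<open>step_node \<sigma> v k \<in> marked \<Gamma>\<close> \<open>v \<notin> marked \<Gamma>\<close> by (intro Least_Suc) auto
    then have "policy_walk \<sigma> v = Finite_Walk v (\<sigma> v #
        map (\<lambda>k. \<sigma> (step_node \<sigma> ?w k)) [0..<LEAST k. step_node \<sigma> ?w k \<in> marked \<Gamma>])"
      using True
      by (simp add: policy_walk_def step_node_Suc' upt_conv_Cons map_Suc_upt[symmetric] o_def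
          del: upt_Suc)
    then show ?thesis
      using w D v by (simp only: walk_sum_Cons policy_walk_def if_True nv_V)
  next
    case False
    have w: "\<not> (\<exists>k. step_node \<sigma> ?w k \<in> marked \<Gamma>)"
      using False by (metis step_node_Suc')
    have W: "policy_walk \<sigma> v = Infinite_Walk (\<lambda>k. \<sigma> (step_node \<sigma> v k))"
        "policy_walk \<sigma> ?w = Infinite_Walk (\<lambda>k. \<sigma> (step_node \<sigma> v (Suc k)))"
      using False w by (simp_all add: policy_walk_def step_node_Suc')
    show ?thesis
      using walk_sum_shift[of "\<lambda>k. \<sigma> (step_node \<sigma> v k)" y] D v V_D[OF v]
        policy_walk_simple[OF \<sigma>, of v] policy_walk_simple[OF \<sigma>, of ?w]
      unfolding W by (simp del: walk_sum.simps)
  qed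
  then show ?thesis by (simp add: policy_val_def[symmetric] arc_val_def)
qed

text \<open>Comparison principle for a fixed policy: its walk uses only edges that \<sigma> selects
  at unmarked nodes, so \<open>walk_sum_bound\<close> needs the inequality only there.\<close>

lemma policy_val_bound:
  assumes \<sigma>: "\<sigma> \<in> policies" and v: "v \<in> verts G"
    and le: "\<And>u. u \<in> V \<Longrightarrow> s * (y u + arc_val x (\<sigma> u)) \<le> s * x u"
  shows "s * policy_val \<sigma> y v \<le> s * nv x v"
proof -
  note W = policy_walk_simple[OF \<sigma> v]
  have "s * walk_sum \<Gamma> (policy_walk \<sigma> v) y \<le> s * nv x (walk_start \<Gamma> (policy_walk \<sigma> v))"
  proof (rule walk_sum_bound)
    fix e assume "e \<in> walk_arcs (policy_walk \<sigma> v)"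
    then obtain u where "u \<in> V" "e = \<sigma> u" using W by blast
    then show "s * (y (tail G e) + cost \<Gamma> e + gain \<Gamma> e * nv x (head G e)) \<le> s * x (tail G e)"
      using le[of u] policyD[OF \<sigma>, of u] by (simp add: arc_val_def add_ac)
  qed (use W in blast)
  then show ?thesis using W by (simp add: policy_val_def)
qed

lemma affine_functional_policy_val:
  "\<sigma> \<in> policies \<Longrightarrow> v \<in> verts G \<Longrightarrow> affine_functional V (\<lambda>y. policy_val \<sigma> y v)"
  using affine_functional_walk_sum policy_walk_simple unfolding policy_val_def by blast

lemma affine_functional_arc_val:
  "e \<in> arcs G \<Longrightarrow> affine_functional V (\<lambda>x. arc_val x e)"
  unfolding arc_val_def
  by (intro affine_functional_add affine_functional_cmult affine_functional_const
      affine_functional_nv) simp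

section \<open>Optimal values and the optimality equation\<close>

lemma policy_val_le_best: "\<sigma> \<in> policies \<Longrightarrow> policy_val \<sigma> y v \<le> best_val y v"
  unfolding best_val_def by (intro Max_ge) auto

lemma best_val_attained:
  obtains \<sigma> where "\<sigma> \<in> policies" "best_val y v = policy_val \<sigma> y v"
proof -
  have "best_val y v \<in> (\<lambda>\<sigma>. policy_val \<sigma> y v) ` policies"
    unfolding best_val_def by (intro Max_in) auto
  then show ?thesis using that by blast
qed

lemma nv_best_val [simp]: "nv (best_val y) v = best_val y v"
  by (metis best_val_attained node_val_def policy_val_marked)

lemma arc_val_le_max: "e \<in> out_arcs G v \<Longrightarrow> arc_val x e \<le> max_val x v"
  unfolding max_val_def by (intro Max_ge) auto

lemma arc_val_mono:
  "e \<in> arcs G \<Longrightarrow> nv x (head G e) \<le> nv z (head G e) \<Longrightarrow> arc_val x e \<le> arc_val z e"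
  using gain_pos[of e] by (simp add: arc_val_def)

text \<open>Supplies the greedy policy of \<open>x\<close>, which replaces all the maxima by one
  choice of edges.\<close>

lemma max_policy:
  obtains \<sigma> where "\<sigma> \<in> policies" "\<And>v. v \<in> V \<Longrightarrow> max_val x v = arc_val x (\<sigma> v)"
proof -
  have "\<exists>e\<in>out_arcs G v. max_val x v = arc_val x e" if "v \<in> V" for v
  proof -
    have "max_val x v \<in> arc_val x ` out_arcs G v"
      unfolding max_val_def using out_arcs_unmarked[OF that] by (intro Max_in) auto
    then show ?thesis by blast
  qed
  then obtain s where "\<And>v. v \<in> V \<Longrightarrow> s v \<in> out_arcs G v \<and> max_val x v = arc_val x (s v)"
    by metis
  then show ?thesis
    by (intro that[of "restrict s V"]) (auto simp: policies_def)
qed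

text \<open>Policy improvement: \<open>best_val y\<close> is a subsolution of the optimality equation, and the values of
  a policy that is greedy for it dominate the right-hand side.\<close>

lemma best_val_solves:
  assumes v: "v \<in> V"
  shows "best_val y v = y v + max_val (best_val y) v"
proof (rule antisym)
  let ?x = "best_val y"
  have sub: "?x u \<le> y u + max_val ?x u" if u: "u \<in> V" for u
  proof -
    obtain \<sigma> where \<sigma>: "\<sigma> \<in> policies" "?x u = policy_val \<sigma> y u" by (rule best_val_attained)
    have "arc_val (policy_val \<sigma> y) (\<sigma> u) \<le> arc_val ?x (\<sigma> u)"
      using policyD[OF \<sigma>(1) u] policy_val_le_best[OF \<sigma>(1)] by (intro arc_val_mono) auto
    also have "\<dots> \<le> max_val ?x u"
      using policyD[OF \<sigma>(1) u] by (intro arc_val_le_max)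
    finally show ?thesis using policy_val_rec[OF \<sigma>(1) u, of y] \<sigma>(2) by simp
  qed
  then show "?x v \<le> y v + max_val ?x v" using v .
  obtain \<tau> where \<tau>: "\<tau> \<in> policies" "\<And>u. u \<in> V \<Longrightarrow> max_val ?x u = arc_val ?x (\<tau> u)"
    using max_policy by blast
  \<comment> \<open>With sign -1, \<open>sub\<close> says that \<open>?x\<close> is a subsolution
    for the greedy policy \<tau>, hence lies below its values.\<close>
  have "?x u \<le> policy_val \<tau> y u" if "u \<in> verts G" for u
    using policy_val_bound[OF \<tau>(1) that, of "-1" y ?x] sub \<tau>(2) by force
  then have "arc_val ?x (\<tau> v) \<le> arc_val (policy_val \<tau> y) (\<tau> v)"
    using policyD[OF \<tau>(1) v] by (intro arc_val_mono) auto
  then have "y v + max_val ?x v \<le> policy_val \<tau> y v"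
    using policy_val_rec[OF \<tau>(1) v] \<tau>(2)[OF v] by simp
  also have "\<dots> \<le> ?x v" using \<tau>(1) by (rule policy_val_le_best)
  finally show "y v + max_val ?x v \<le> ?x v" .
qed

text \<open>The maximum dominates every outgoing edge, so \<open>x\<close> is a supersolution along
  any simple walk, not only along walks of policies. This reduces the walk inequalities to
  policies.\<close>

lemma solution_ge_walk_sum:
  assumes x: "\<And>v. v \<in> V \<Longrightarrow> x v = y v + max_val x v" and W: "W \<in> simple_walks \<Gamma>"
  shows "walk_sum \<Gamma> W y \<le> nv x (walk_start \<Gamma> W)"
proof -
  have arcs: "e \<in> arcs G \<and> tail G e \<in> V" if "e \<in> walk_arcs W" for e
  proof (cases W)
    case (Finite_Walk u p)
    have "admissible_walk \<Gamma> (Finite_Walk u p) \<Longrightarrow> e \<in> set p \<Longrightarrow> e \<in> arcs G \<and> tail G e \<in> V"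
    proof (induction p arbitrary: u)
      case (Cons e' p)
      note D = admissible_ConsD[OF Cons.prems(1)]
      show ?case using Cons.IH[OF D(4)] D Cons.prems(2) by (cases "e = e'") auto
    qed simp
    then show ?thesis using that simple_walksD(1)[OF W] Finite_Walk by simp
  next
    case (Infinite_Walk f)
    then show ?thesis using that simple_walksD(1)[OF W] by auto
  qed
  have "1 * walk_sum \<Gamma> W y \<le> 1 * nv x (walk_start \<Gamma> W)"
  proof (rule walk_sum_bound[OF W])
    fix e assume "e \<in> walk_arcs W"
    note e = arcs[OF this]
    have "arc_val x e \<le> max_val x (tail G e)" using e by (intro arc_val_le_max) simp
    then show "1 * (y (tail G e) + cost \<Gamma> e + gain \<Gamma> e * nv x (head G e)) \<le> 1 * x (tail G e)"
      using x[of "tail G e"] e by (simp add: arc_val_def)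
  qed
  then show ?thesis by simp
qed

text \<open>For a greedy policy the optimality equation is an equality along the chosen edges, so
  the comparison principle applies with both signs.\<close>

lemma solution_eq_policy_val:
  assumes x: "\<And>v. v \<in> V \<Longrightarrow> x v = y v + max_val x v"
    and \<sigma>: "\<sigma> \<in> policies" "\<And>v. v \<in> V \<Longrightarrow> max_val x v = arc_val x (\<sigma> v)" and v: "v \<in> verts G"
  shows "nv x v = policy_val \<sigma> y v"
  using policy_val_bound[OF \<sigma>(1) v, of 1 y x] policy_val_bound[OF \<sigma>(1) v, of "-1" y x] x \<sigma>(2)
  by force

text \<open>The greedy policy of \<open>x\<close> bounds \<open>x\<close> from above by
  \<open>best_val y\<close>; conversely \<open>x\<close> dominates every walk sum, in particular
  that of an optimal policy.\<close>

lemma solution_unique: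
  assumes x: "\<And>v. v \<in> V \<Longrightarrow> x v = y v + max_val x v" and v: "v \<in> verts G"
  shows "nv x v = best_val y v"
proof (rule antisym)
  obtain \<sigma> where \<sigma>: "\<sigma> \<in> policies" "\<And>v. v \<in> V \<Longrightarrow> max_val x v = arc_val x (\<sigma> v)"
    using max_policy by blast
  show "nv x v \<le> best_val y v"
    using solution_eq_policy_val[OF x \<sigma> v] policy_val_le_best[OF \<sigma>(1)] by simp
  obtain \<tau> where \<tau>: "\<tau> \<in> policies" "best_val y v = policy_val \<tau> y v" by (rule best_val_attained)
  show "best_val y v \<le> nv x v"
    using solution_ge_walk_sum[OF x, of "policy_walk \<tau> v"] policy_walk_simple[OF \<tau>(1) v] \<tau>(2)
    by (simp add: policy_val_def)
qed


section \<open>The transfer map and its inverse\<close>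

text \<open>\<open>best_val y\<close> also has the markings as values; the restriction makes it a
  point of the coordinate space over \<open>V\<close>.\<close>

definition inverse_map :: "('v \<Rightarrow> real) \<Rightarrow> 'v \<Rightarrow> real" where
  "inverse_map y = restrict (best_val y) V"

lemma transfer_map_eq: "transfer_map \<Gamma> x = (\<lambda>v\<in>V. x v - max_val x v)"
  by (simp add: transfer_map_def max_val_def arc_val_def)

lemma nv_restrict [simp]: "v \<in> verts G \<Longrightarrow> nv (restrict x V) v = nv x v"
  using verts_cases[of v] by (auto simp: node_val_def)

lemma max_val_cong:
  "(\<And>v. v \<in> verts G \<Longrightarrow> nv x v = nv z v) \<Longrightarrow> max_val x v = max_val z v"
  unfolding max_val_def arc_val_def by (intro arg_cong[of _ _ Max] image_cong) auto

lemma max_val_inverse_map: "max_val (inverse_map y) v = max_val (best_val y) v"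
  by (rule max_val_cong) (simp add: inverse_map_def del: nv_best_val)

lemma inverse_map_solves: "v \<in> V \<Longrightarrow> inverse_map y v = y v + max_val (inverse_map y) v"
  unfolding max_val_inverse_map using best_val_solves[of v y] by (simp add: inverse_map_def)

lemma nv_inverse_map: "v \<in> verts G \<Longrightarrow> nv (inverse_map y) v = best_val y v"
  unfolding inverse_map_def by simp

section \<open>Edge inequalities against walk inequalities\<close>

lemma O_polyhedron_eq:
  "O_polyhedron \<Gamma> = {x \<in> V \<rightarrow>\<^sub>E UNIV. \<forall>e\<in>arcs G. arc_val x e \<le> nv x (tail G e)}"
  by (simp add: O_polyhedron_def arc_val_def)

text \<open>Policy walks are simple, and conversely the sum of any simple walk is at most the best
  policy value at its start; positive gain preserves this. The walk inequalities thus become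
  finitely many, indexed by edges and policies.\<close>

lemma C_polyhedron_eq:
  "C_polyhedron \<Gamma> = {y \<in> V \<rightarrow>\<^sub>E UNIV. (\<forall>v\<in>V. 0 \<le> y v) \<and>
     (\<forall>e\<in>arcs G. tail G e \<in> marked \<Gamma> \<longrightarrow>
        (\<forall>\<sigma>\<in>policies. arc_val (policy_val \<sigma> y) e \<le> marking \<Gamma> (tail G e)))}"
proof -
  have "(\<forall>a\<in>marked \<Gamma>. \<forall>e\<in>out_arcs G a. \<forall>W\<in>simple_walks \<Gamma>. walk_start \<Gamma> W = head G e \<longrightarrow>
        gain \<Gamma> e * walk_sum \<Gamma> W y + cost \<Gamma> e \<le> marking \<Gamma> a) \<longleftrightarrow>
      (\<forall>e\<in>arcs G. tail G e \<in> marked \<Gamma> \<longrightarrow>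
        (\<forall>\<sigma>\<in>policies. arc_val (policy_val \<sigma> y) e \<le> marking \<Gamma> (tail G e)))" (is "?L \<longleftrightarrow> ?R") for y
  proof
    assume L: ?L
    show ?R
    proof (intro ballI impI)
      fix e \<sigma> assume e: "e \<in> arcs G" "tail G e \<in> marked \<Gamma>" and \<sigma>: "\<sigma> \<in> policies"
      show "arc_val (policy_val \<sigma> y) e \<le> marking \<Gamma> (tail G e)"
        using L e policy_walk_simple[OF \<sigma>, of "head G e"]
        by (simp add: arc_val_def policy_val_def[of \<sigma> y "head G e"])
    qed
  next
    assume R: ?R
    show ?L
    proof (intro ballI impI)
      fix a e W assume "a \<in> marked \<Gamma>" "e \<in> out_arcs G a" and W: "W \<in> simple_walks \<Gamma>"
        and start: "walk_start \<Gamma> W = head G e"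
      then have e: "e \<in> arcs G" "tail G e = a" "tail G e \<in> marked \<Gamma>" by auto
      obtain \<sigma> where \<sigma>: "\<sigma> \<in> policies" "best_val y (head G e) = policy_val \<sigma> y (head G e)"
        by (rule best_val_attained)
      have "walk_sum \<Gamma> W y \<le> policy_val \<sigma> y (head G e)"
        using solution_ge_walk_sum[OF best_val_solves[of _ y] W] start \<sigma>(2) by simp
      then have "gain \<Gamma> e * walk_sum \<Gamma> W y + cost \<Gamma> e \<le> arc_val (policy_val \<sigma> y) e"
        using gain_pos[OF e(1)] by (simp add: arc_val_def)
      then show "gain \<Gamma> e * walk_sum \<Gamma> W y + cost \<Gamma> e \<le> marking \<Gamma> a"
        using R e \<sigma>(1) by fastforce
    qed
  qed
  then show ?thesis unfolding C_polyhedron_def by simp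
qed

text \<open>Edge inequalities at unmarked tails amount to nonnegativity of \<open>y\<close>. Those
  at marked tails give the policy inequalities, since \<open>x\<close> agrees with
  \<open>best_val y\<close> by uniqueness.\<close>

lemma transfer_map_in_C:
  assumes x: "x \<in> O_polyhedron \<Gamma>"
  shows "transfer_map \<Gamma> x \<in> C_polyhedron \<Gamma>" "inverse_map (transfer_map \<Gamma> x) = x"
proof -
  define y where "y = transfer_map \<Gamma> x"
  have sol: "x v = y v + max_val x v" if "v \<in> V" for v
    using that by (simp add: y_def transfer_map_eq)
  have O: "arc_val x e \<le> nv x (tail G e)" if "e \<in> arcs G" for e
    using x that by (simp add: O_polyhedron_eq)
  have "0 \<le> y v" if v: "v \<in> V" for v
  proof -
    obtain \<sigma> where "\<sigma> \<in> policies" "max_val x v = arc_val x (\<sigma> v)"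
      using max_policy[of x] v by metis
    then show ?thesis using O[of "\<sigma> v"] policyD[of \<sigma> v] v sol[OF v] by simp
  qed
  moreover have "arc_val (policy_val \<sigma> y) e \<le> marking \<Gamma> (tail G e)"
    if e: "e \<in> arcs G" "tail G e \<in> marked \<Gamma>" and \<sigma>: "\<sigma> \<in> policies" for e \<sigma>
  proof -
    have "arc_val (policy_val \<sigma> y) e \<le> arc_val x e"
      using e solution_unique[OF sol, of "head G e"] policy_val_le_best[OF \<sigma>]
      by (intro arc_val_mono) auto
    then show ?thesis using O[OF e(1)] e(2) by (simp add: node_val_def)
  qed
  moreover have "y \<in> V \<rightarrow>\<^sub>E UNIV" by (simp add: y_def transfer_map_eq)
  ultimately have "y \<in> C_polyhedron \<Gamma>" unfolding C_polyhedron_eq by blast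
  then show "transfer_map \<Gamma> x \<in> C_polyhedron \<Gamma>" by (simp add: y_def)
  have "inverse_map y v = x v" for v
  proof (cases "v \<in> V")
    case True
    then show ?thesis using solution_unique[OF sol, of v] V_D[OF True] by (simp add: inverse_map_def)
  next
    case False
    \<comment> \<open>Outside \<open>V\<close> both sides are \<open>undefined\<close> by
      extensionality.\<close>
    then show ?thesis using x by (auto simp: inverse_map_def O_polyhedron_eq PiE_def extensional_def)
  qed
  then show "inverse_map (transfer_map \<Gamma> x) = x" by (auto simp: y_def)
qed

text \<open>At a marked tail, the inequality for a policy optimal at the head of the edge is exactly
  the edge inequality; at an unmarked tail, the optimality equation and nonnegativity of
  \<open>y\<close> give it.\<close>

lemma inverse_map_in_O:
  assumes y: "y \<in> C_polyhedron \<Gamma>"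
  shows "inverse_map y \<in> O_polyhedron \<Gamma>" "transfer_map \<Gamma> (inverse_map y) = y"
proof -
  let ?x = "inverse_map y"
  have "arc_val ?x e \<le> nv ?x (tail G e)" if e: "e \<in> arcs G" for e
  proof (cases "tail G e \<in> marked \<Gamma>")
    case True
    obtain \<sigma> where \<sigma>: "\<sigma> \<in> policies" "best_val y (head G e) = policy_val \<sigma> y (head G e)"
      by (rule best_val_attained)
    have "arc_val ?x e = arc_val (policy_val \<sigma> y) e"
      using e \<sigma>(2) by (simp add: arc_val_def nv_inverse_map)
    also have "\<dots> \<le> marking \<Gamma> (tail G e)"
      using y e True \<sigma>(1) by (auto simp: C_polyhedron_eq)
    finally show ?thesis using True by (simp add: node_val_def)
  next
    case False
    then have V: "tail G e \<in> V" using e by (simp add: unmarked_def)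
    then have "0 \<le> y (tail G e)" using y by (simp add: C_polyhedron_eq)
    then show ?thesis
      using inverse_map_solves[OF V, of y] arc_val_le_max[of e "tail G e" ?x] e V by simp
  qed
  then show "?x \<in> O_polyhedron \<Gamma>"
    by (simp add: O_polyhedron_eq inverse_map_def)
  show "transfer_map \<Gamma> ?x = y"
  proof
    fix v
    show "transfer_map \<Gamma> ?x v = y v"
      using inverse_map_solves[of v y] y
      by (cases "v \<in> V") (auto simp: transfer_map_eq C_polyhedron_eq PiE_def extensional_def)
  qed
qed

section \<open>Continuity of both maps\<close>

lemma continuous_transfer_map:
  "continuous_map (powertop_real V) (powertop_real V) (transfer_map \<Gamma>)"
proof -
  have "continuous_map (powertop_real V) euclideanreal (\<lambda>x. x v - max_val x v)" if v: "v \<in> V" for v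
    unfolding max_val_def using v out_arcs_unmarked
    by (intro continuous_map_diff continuous_map_Max continuous_map_affine_functional
        affine_functional_coord affine_functional_arc_val) auto
  then have "continuous_map (powertop_real V) euclideanreal (\<lambda>x. transfer_map \<Gamma> x v)" if "v \<in> V" for v
    using that by (simp add: transfer_map_eq)
  then show ?thesis
    by (auto simp: continuous_map_componentwise transfer_map_eq)
qed

lemma continuous_inverse_map:
  "continuous_map (powertop_real V) (powertop_real V) inverse_map"
proof -
  have "continuous_map (powertop_real V) euclideanreal (\<lambda>y. best_val y v)" if v: "v \<in> V" for v
    unfolding best_val_def using V_D[OF v]
    by (intro continuous_map_Max continuous_map_affine_functional affine_functional_policy_val) auto
  then have "continuous_map (powertop_real V) euclideanreal (\<lambda>y. inverse_map y v)" if "v \<in> V" for v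
    using that by (simp add: inverse_map_def)
  then show ?thesis
    by (auto simp: continuous_map_componentwise inverse_map_def)
qed

section \<open>Polyhedrality and the affine pieces\<close>

lemma polyhedron_O: "polyhedron_in V (O_polyhedron \<Gamma>)"
  unfolding O_polyhedron_eq
  by (intro polyhedron_inI affine_functional_arc_val affine_functional_nv) auto

lemma polyhedron_C: "polyhedron_in V (C_polyhedron \<Gamma>)"
proof -
  let ?E = "{e \<in> arcs G. tail G e \<in> marked \<Gamma>} \<times> policies"
  have "affine_functional V (\<lambda>y. arc_val (policy_val (snd i) y) (fst i))" if "i \<in> ?E" for i
    unfolding arc_val_def nv_policy_val using that
    by (intro affine_functional_add affine_functional_cmult affine_functional_const
        affine_functional_policy_val) auto
  then have "polyhedron_in V {y \<in> V \<rightarrow>\<^sub>E UNIV. \<forall>i\<in>?E.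
      arc_val (policy_val (snd i) y) (fst i) \<le> marking \<Gamma> (tail G (fst i))}"
    by (intro polyhedron_inI affine_functional_const) auto
  moreover have "polyhedron_in V {y \<in> V \<rightarrow>\<^sub>E UNIV. \<forall>v\<in>V. 0 \<le> y v}"
    by (intro polyhedron_inI affine_functional_const affine_functional_coord) auto
  moreover have "C_polyhedron \<Gamma> = {y \<in> V \<rightarrow>\<^sub>E UNIV. \<forall>v\<in>V. 0 \<le> y v} \<inter> {y \<in> V \<rightarrow>\<^sub>E UNIV. \<forall>i\<in>?E.
      arc_val (policy_val (snd i) y) (fst i) \<le> marking \<Gamma> (tail G (fst i))}"
    unfolding C_polyhedron_eq by auto
  ultimately show ?thesis by (simp only: polyhedron_in_Int)
qed

lemma piecewise_affine_transfer_map: "piecewise_affine_on V (O_polyhedron \<Gamma>) (transfer_map \<Gamma>)"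
proof -
  define E where "E = {e \<in> arcs G. tail G e \<in> V}"
  \<comment> \<open>The piece of \<sigma> consists of the points for which \<sigma> is greedy at
    every unmarked node; on it each maximum is a single affine term.\<close>
  define P where "P \<sigma> = O_polyhedron \<Gamma> \<inter>
    {x \<in> V \<rightarrow>\<^sub>E UNIV. \<forall>e\<in>E. arc_val x e \<le> arc_val x (\<sigma> (tail G e))}" for \<sigma>
  have greedy: "max_val x v = arc_val x (\<sigma> v)" if "\<sigma> \<in> policies" "x \<in> P \<sigma>" "v \<in> V" for \<sigma> x v
    unfolding max_val_def using that policyD[of \<sigma> v] by (intro Max_eqI) (auto simp: P_def E_def)
  have "polyhedron_in V (P \<sigma>) \<and> affine_map_on V (P \<sigma>) (transfer_map \<Gamma>)" if \<sigma>: "\<sigma> \<in> policies" for \<sigma>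
  proof
    show "polyhedron_in V (P \<sigma>)"
      unfolding P_def
      by (intro polyhedron_in_Int polyhedron_O polyhedron_inI affine_functional_arc_val)
         (auto simp: E_def policyD[OF \<sigma>])
    show "affine_map_on V (P \<sigma>) (transfer_map \<Gamma>)"
    proof (rule affine_map_onI)
      fix u assume "u \<in> V"
      then show "affine_functional V (\<lambda>x. x u - arc_val x (\<sigma> u))"
        using policyD[OF \<sigma>]
        by (intro affine_functional_diff affine_functional_coord affine_functional_arc_val) auto
    qed (simp add: transfer_map_eq greedy[OF \<sigma>])
  qed
  moreover have "O_polyhedron \<Gamma> \<subseteq> \<Union> (P ` policies)"
  proof
    fix x assume x: "x \<in> O_polyhedron \<Gamma>"
    obtain \<sigma> where \<sigma>: "\<sigma> \<in> policies" "\<And>v. v \<in> V \<Longrightarrow> max_val x v = arc_val x (\<sigma> v)"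
      using max_policy by blast
    have "arc_val x e \<le> arc_val x (\<sigma> (tail G e))" if "e \<in> E" for e
      using arc_val_le_max[of e "tail G e" x] \<sigma>(2)[of "tail G e"] that by (simp add: E_def)
    then have "x \<in> P \<sigma>" using x by (simp add: P_def O_polyhedron_eq)
    then show "x \<in> \<Union> (P ` policies)" using \<sigma>(1) by blast
  qed
  moreover have "\<Union> (P ` policies) \<subseteq> O_polyhedron \<Gamma>" by (auto simp: P_def)
  ultimately show ?thesis
    unfolding piecewise_affine_on_def by (intro exI[of _ "P ` policies"]) auto
qed

lemma piecewise_affine_inverse_map: "piecewise_affine_on V (C_polyhedron \<Gamma>) inverse_map"
proof -
  \<comment> \<open>Here the piece of \<sigma> consists of the points for which \<sigma> is optimal
    at all unmarked nodes simultaneously.\<close>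
  define P where "P \<sigma> = C_polyhedron \<Gamma> \<inter>
    {y \<in> V \<rightarrow>\<^sub>E UNIV. \<forall>i\<in>V \<times> policies. policy_val (snd i) y (fst i) \<le> policy_val \<sigma> y (fst i)}" for \<sigma>
  have best: "best_val y v = policy_val \<sigma> y v" if "\<sigma> \<in> policies" "y \<in> P \<sigma>" "v \<in> V" for \<sigma> y v
    unfolding best_val_def using that by (intro Max_eqI) (auto simp: P_def)
  have "polyhedron_in V (P \<sigma>) \<and> affine_map_on V (P \<sigma>) inverse_map" if \<sigma>: "\<sigma> \<in> policies" for \<sigma>
  proof
    show "polyhedron_in V (P \<sigma>)"
      unfolding P_def using V_D \<sigma>
      by (intro polyhedron_in_Int polyhedron_C polyhedron_inI affine_functional_policy_val) auto
    show "affine_map_on V (P \<sigma>) inverse_map"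
    proof (rule affine_map_onI)
      show "affine_functional V (\<lambda>y. policy_val \<sigma> y u)" if "u \<in> V" for u
        using V_D[OF that] \<sigma> by (intro affine_functional_policy_val) auto
    qed (simp add: inverse_map_def best[OF \<sigma>])
  qed
  moreover have "C_polyhedron \<Gamma> \<subseteq> \<Union> (P ` policies)"
  proof
    fix y assume y: "y \<in> C_polyhedron \<Gamma>"
    obtain \<sigma> where \<sigma>: "\<sigma> \<in> policies" "\<And>v. v \<in> V \<Longrightarrow> max_val (best_val y) v = arc_val (best_val y) (\<sigma> v)"
      using max_policy by blast
    \<comment> \<open>A policy greedy for \<open>best_val y\<close> is optimal at every node at
      once, which is why the pieces cover although the maximum is formed node by node.\<close>
    have "best_val y v = policy_val \<sigma> y v" if "v \<in> V" for v
      using solution_eq_policy_val[OF best_val_solves \<sigma>, of v] V_D[OF that] by simp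
    then have "policy_val \<tau> y v \<le> policy_val \<sigma> y v" if "v \<in> V" "\<tau> \<in> policies" for v \<tau>
      using policy_val_le_best[OF that(2), of y v] that by simp
    then have "y \<in> P \<sigma>" using y by (auto simp: P_def C_polyhedron_eq)
    then show "y \<in> \<Union> (P ` policies)" using \<sigma>(1) by blast
  qed
  moreover have "\<Union> (P ` policies) \<subseteq> C_polyhedron \<Gamma>" by (auto simp: P_def)
  ultimately show ?thesis
    unfolding piecewise_affine_on_def by (intro exI[of _ "P ` policies"]) auto
qed

lemma PL_homeomorphism_transfer_map:
  "PL_homeomorphism V (O_polyhedron \<Gamma>) (C_polyhedron \<Gamma>) (transfer_map \<Gamma>)"
proof -
  have "homeomorphic_maps (subtopology (powertop_real V) (O_polyhedron \<Gamma>))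
      (subtopology (powertop_real V) (C_polyhedron \<Gamma>)) (transfer_map \<Gamma>) inverse_map"
    unfolding homeomorphic_maps_def continuous_map_in_subtopology
    using transfer_map_in_C inverse_map_in_O
    by (auto intro!: continuous_map_from_subtopology continuous_transfer_map continuous_inverse_map)
  then show ?thesis
    unfolding PL_homeomorphism_def
    using piecewise_affine_transfer_map piecewise_affine_inverse_map by blast
qed

end

theorem theorem4p2:
  fixes \<Gamma> :: "('v, 'e) network"
  assumes "marked_network \<Gamma>"
    and "gainy \<Gamma>"
    and "all_sinks_marked \<Gamma>"
  shows "PL_homeomorphism (unmarked \<Gamma>) (O_polyhedron \<Gamma>) (C_polyhedron \<Gamma>) (transfer_map \<Gamma>)"
proof -
  interpret fin_digraph "graph \<Gamma>" using assms(1) by (simp add: marked_network_def)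
  interpret gainy_network \<Gamma>
    using assms
    by unfold_locales
       (auto simp: marked_network_def gainy_def all_sinks_marked_def unmarked_def)
  show ?thesis by (rule PL_homeomorphism_transfer_map)
qed

end
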